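(* Let $p\ge1$, $q\ge0$ be integers and let $\mathbb{R}^{p,q}$ be equipped with its canonical metric of signature $(p,q)$. Let $c_1,c_2$ be real constants with $c_1\neq0$ and let $H:\mathbb{R}^{p,q}\to\mathbb{R}$ be defined by $$H(x_1,\ldots,x_p,y_1,\ldots,y_q)=c_1\left(\sum_{i=1}^p x_i^2-\sum_{j=1}^q y_j^2\right)+c_2 .$$ Let $s\ge1$ be an integer. If $F:U\subset\mathbb{R}^{p,q}\to\mathbb{R}$ is an $s$-harmonic function on an open set $U$, then the product function $G=H\,F$ is $(s+1)$-harmonic on $U$. Moreover, if $F$ is proper $s$-harmonic on the whole of $\mathbb{R}^{p,q}$, then $G$ is proper $(s+1)$-harmonic on $\mathbb{R}^{p,q}$.
   Context: $\mathbb{R}^{p,q}$ is $\mathbb{R}^{p+q}$ with Cartesian coordinates $(x,y)=(x_1,\ldots,x_p,y_1,\ldots,y_q)$ and the metric $g=\operatorname{diag}(I_p,-I_q)$. Its Laplacian is $$\Delta F=\sum_{i=1}^p\frac{\partial^2F}{\partial x_i^2}-\sum_{j=1}^q\frac{\partial^2F}{\partial y_j^2}.$$ Iterates: $\Delta^0F=F$, $\Delta^sF=\Delta(\Delta^{s-1}F)$. A smooth real-valued function $F$ is $s$-harmonic if $\Delta^sF=0$, and proper $s$-harmonic if moreover $\Delta^{s-1}F$ does not vanish identically. The case $q=0$ is the Euclidean space. *)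

theory Defs
  imports "HOL-Analysis.Analysis"
begin

text \<open>
  The pseudo-Euclidean space of signature (p,q) is modelled by \<open>real ^ 'n\<close> together with the set
  \<open>P\<close> of those indices whose coordinates are the \<open>x\<close>-coordinates; the indices in \<open>- P\<close> carry the
  \<open>y\<close>-coordinates. Thus \<open>card P = p\<close> and \<open>card (- P) = q\<close>; the case \<open>q = 0\<close> is \<open>P = UNIV\<close>,
  which could not be obtained from a sum of two (nonempty) index types.

  A function on an open set \<open>U\<close> is a total function of which only the values on \<open>U\<close> matter.
\<close>

definition partial_deriv :: "'n::finite \<Rightarrow> (real ^ 'n \<Rightarrow> real) \<Rightarrow> real ^ 'n \<Rightarrow> real" where
  "partial_deriv i F z = deriv (\<lambda>t. F (z + t *\<^sub>R axis i 1)) 0"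

text \<open>
  The definitions below are meant for open \<open>U\<close> only. Requiring (total) differentiability besides
  \<open>C\<^sup>k\<close> partial derivatives is the usual notion of \<open>C\<^sup>k\<^sup>+\<^sup>1\<close>, and it ensures
  that \<open>deriv\<close> is never applied where a partial derivative fails to exist.
\<close>

primrec Ck_on :: "nat \<Rightarrow> (real ^ 'n::finite) set \<Rightarrow> (real ^ 'n \<Rightarrow> real) \<Rightarrow> bool" where
  "Ck_on 0 U F \<longleftrightarrow> continuous_on U F"
| "Ck_on (Suc k) U F \<longleftrightarrow> (\<forall>z\<in>U. F differentiable (at z)) \<and> (\<forall>i. Ck_on k U (partial_deriv i F))"

definition smooth_on :: "(real ^ 'n::finite) set \<Rightarrow> (real ^ 'n \<Rightarrow> real) \<Rightarrow> bool" where
  "smooth_on U F \<longleftrightarrow> (\<forall>k. Ck_on k U F)"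

definition laplacian :: "'n::finite set \<Rightarrow> (real ^ 'n \<Rightarrow> real) \<Rightarrow> real ^ 'n \<Rightarrow> real" where
  "laplacian P F z =
     (\<Sum>i\<in>P. partial_deriv i (partial_deriv i F) z) - (\<Sum>j\<in>- P. partial_deriv j (partial_deriv j F) z)"

definition s_harmonic_on ::
    "'n::finite set \<Rightarrow> nat \<Rightarrow> (real ^ 'n) set \<Rightarrow> (real ^ 'n \<Rightarrow> real) \<Rightarrow> bool" where
  "s_harmonic_on P s U F \<longleftrightarrow> smooth_on U F \<and> (\<forall>z\<in>U. (laplacian P ^^ s) F z = 0)"

definition proper_s_harmonic_on ::
    "'n::finite set \<Rightarrow> nat \<Rightarrow> (real ^ 'n) set \<Rightarrow> (real ^ 'n \<Rightarrow> real) \<Rightarrow> bool" where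
  "proper_s_harmonic_on P s U F \<longleftrightarrow>
     s_harmonic_on P s U F \<and> (\<exists>z\<in>U. (laplacian P ^^ (s - 1)) F z \<noteq> 0)"

end

theory Submission
  imports Defs
begin

text \<open>
  Let \<open>\<Delta>\<close> be the Laplacian, \<open>m\<close> the dimension and \<open>E = \<Sum>\<^sub>i z\<^sub>i \<partial>\<^sub>i\<close> the Euler operator. The function
  \<open>H\<close> has gradient proportional to the position vector (in the given metric), so the product rule
  gives \<open>\<Delta>(H F) = H \<Delta>F + c\<^sub>1 (4 E F + 2 m F)\<close>. Since partial derivatives commute, one also has
  \<open>\<Delta> E = E \<Delta> + 2 \<Delta>\<close>, and induction yields, in \<open>laplacian_power_quadratic_mult\<close>,
  \<open>\<Delta>\<^sup>k\<^sup>+\<^sup>1(H F) = H \<Delta>\<^sup>k\<^sup>+\<^sup>1F + c\<^sub>1 (k + 1) (4 E \<Delta>\<^sup>kF + (2 m + 4 k) \<Delta>\<^sup>kF)\<close>.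

  For \<open>k = s\<close> every term on the right contains \<open>\<Delta>\<^sup>sF = 0\<close>, whence the first claim. For \<open>k = s - 1\<close>
  and \<open>u = \<Delta>\<^sup>s\<^sup>-\<^sup>1F\<close> the right-hand side is \<open>2 s c\<^sub>1 (2 E u + n u)\<close> with \<open>n = m + 2 (s - 1) > 0\<close>. Were it
  identically zero, \<open>u\<close> would be homogeneous of the negative degree \<open>- n / 2\<close>; a function that is
  differentiable also at the origin can only be so if it vanishes
  (\<open>euler_negative_degree_imp_zero\<close>), which properness of \<open>F\<close> excludes. This last step uses the
  whole rays to the origin, and is the reason why the second claim concerns the whole space.
\<close>

section \<open>Partial derivatives\<close>

lemma partial_deriv_eq:
  assumes "(F has_derivative F') (at z)"
  shows "partial_deriv i F z = F' (axis i 1)"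
proof -
  interpret F': bounded_linear F' using assms by (rule has_derivative_bounded_linear)
  have "((\<lambda>t. z + t *\<^sub>R axis i 1) has_derivative (\<lambda>t. t *\<^sub>R axis i 1)) (at (0::real))"
    by (auto intro!: derivative_eq_intros)
  moreover have "(F has_derivative F') (at (z + 0 *\<^sub>R axis i 1))" using assms by simp
  ultimately have "((\<lambda>t. F (z + t *\<^sub>R axis i 1)) has_derivative (\<lambda>t. F' (t *\<^sub>R axis i 1))) (at 0)"
    by (rule has_derivative_compose)
  moreover have "(\<lambda>t. F' (t *\<^sub>R axis i 1)) = (*) (F' (axis i 1))"
    by (simp add: F'.scaleR fun_eq_iff)
  ultimately show ?thesis
    unfolding partial_deriv_def by (intro DERIV_imp_deriv) (simp add: has_field_derivative_def)
qed

lemma has_derivative_partial_deriv: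
  assumes "F differentiable (at z)"
  shows "(F has_derivative (\<lambda>v. \<Sum>i\<in>UNIV. v $ i * partial_deriv i F z)) (at z)"
proof -
  obtain F' where F': "(F has_derivative F') (at z)"
    using assms by (auto simp: differentiable_def)
  interpret F': bounded_linear F' using F' by (rule has_derivative_bounded_linear)
  have "F' v = (\<Sum>i\<in>UNIV. v $ i * partial_deriv i F z)" for v
  proof -
    have "F' v = F' (\<Sum>i\<in>UNIV. v $ i *\<^sub>R axis i 1)"
      using basis_expansion[of v] by (simp add: scalar_mult_eq_scaleR)
    then show ?thesis by (simp add: F'.sum F'.scaleR partial_deriv_eq[OF F'])
  qed
  then have "F' = (\<lambda>v. \<Sum>i\<in>UNIV. v $ i * partial_deriv i F z)" by (rule ext)
  with F' show ?thesis by simp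
qed

lemma DERIV_along_line:
  assumes "F differentiable (at (z + t *\<^sub>R v))"
  shows "((\<lambda>t. F (z + t *\<^sub>R v)) has_real_derivative
           (\<Sum>i\<in>UNIV. v $ i * partial_deriv i F (z + t *\<^sub>R v))) (at t)"
proof -
  have "((\<lambda>t. z + t *\<^sub>R v) has_derivative (\<lambda>t. t *\<^sub>R v)) (at t)"
    by (auto intro!: derivative_eq_intros)
  from has_derivative_compose[OF this has_derivative_partial_deriv[OF assms]]
  show ?thesis
    by (simp add: has_field_derivative_def mult.assoc sum_distrib_left[symmetric] mult_commute_abs)
qed

lemma DERIV_along_axis:
  assumes "F differentiable (at (z + t *\<^sub>R axis i 1))"
  shows "((\<lambda>t. F (z + t *\<^sub>R axis i 1)) has_real_derivative
           partial_deriv i F (z + t *\<^sub>R axis i 1)) (at t)"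
proof -
  have "(\<Sum>j\<in>UNIV. axis i 1 $ j * partial_deriv j F (z + t *\<^sub>R axis i 1))
        = partial_deriv i F (z + t *\<^sub>R axis i 1)"
    by (simp add: axis_def if_distrib[of "\<lambda>x. x * _"] cong: if_cong)
  with DERIV_along_line[OF assms] show ?thesis by simp
qed

text \<open>
  Calculation rules for derivatives hold only on the domain \<open>U\<close>, while a second derivative is taken
  of the total function given by the first one; locality lets the rules be used inside another
  derivative.
\<close>

lemma partial_deriv_cong:
  assumes "open U" and "z \<in> U" and "\<And>w. w \<in> U \<Longrightarrow> F w = G w"
  shows "partial_deriv i F z = partial_deriv i G z"
  unfolding partial_deriv_def
proof (rule deriv_cong_ev)
  have "open ((\<lambda>t::real. z + t *\<^sub>R axis i 1) -` U)"
    using \<open>open U\<close> by (intro open_vimage continuous_intros)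
  then show "\<forall>\<^sub>F t in nhds 0. F (z + t *\<^sub>R axis i 1) = G (z + t *\<^sub>R axis i 1)"
    using assms by (auto simp: eventually_nhds)
qed simp

lemma partial_deriv_const: "partial_deriv i (\<lambda>z. c) z = 0"
  by (simp add: partial_deriv_def)

lemma partial_deriv_coordinate: "partial_deriv i (\<lambda>z. z $ j) z = (if i = j then 1 else 0)"
proof -
  have "((\<lambda>z. z $ j) has_derivative (\<lambda>v. v $ j)) (at z)"
    by (rule bounded_linear.has_derivative) (auto intro!: bounded_linear_vec_nth has_derivative_ident)
  from partial_deriv_eq[OF this] show ?thesis by (simp add: axis_def)
qed

lemma partial_deriv_add:
  assumes "F differentiable (at z)" and "G differentiable (at z)"
  shows "partial_deriv i (\<lambda>z. F z + G z) z = partial_deriv i F z + partial_deriv i G z"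
proof -
  obtain F' G' where F': "(F has_derivative F') (at z)" and G': "(G has_derivative G') (at z)"
    using assms by (auto simp: differentiable_def)
  show ?thesis
    by (simp add: partial_deriv_eq[OF has_derivative_add[OF F' G']]
        partial_deriv_eq[OF F'] partial_deriv_eq[OF G'])
qed

lemma partial_deriv_mult:
  assumes "F differentiable (at z)" and "G differentiable (at z)"
  shows "partial_deriv i (\<lambda>z. F z * G z) z = F z * partial_deriv i G z + partial_deriv i F z * G z"
proof -
  obtain F' G' where F': "(F has_derivative F') (at z)" and G': "(G has_derivative G') (at z)"
    using assms by (auto simp: differentiable_def)
  show ?thesis
    by (simp add: partial_deriv_eq[OF has_derivative_mult[OF F' G']]
        partial_deriv_eq[OF F'] partial_deriv_eq[OF G'])
qed

section \<open>Smooth functions\<close>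

lemma Ck_on_continuous_on: "Ck_on k U F \<Longrightarrow> continuous_on U F"
  by (cases k) (auto intro!: differentiable_imp_continuous_on
      simp: differentiable_on_def differentiable_at_withinI)

lemma Ck_on_Suc_imp: "Ck_on (Suc k) U F \<Longrightarrow> Ck_on k U F"
proof (induction k arbitrary: F)
  case 0
  then show ?case using Ck_on_continuous_on[of "Suc 0" U F] by simp
next
  case (Suc k)
  then show ?case using Ck_on.simps(2) by blast
qed

lemma Ck_on_cong:
  assumes "open U" and "Ck_on k U F" and "\<And>z. z \<in> U \<Longrightarrow> F z = G z"
  shows "Ck_on k U G"
  using assms(2,3)
proof (induction k arbitrary: F G)
  case 0
  then show ?case by (metis Ck_on.simps(1) continuous_on_cong)
next
  case (Suc k)
  have "G differentiable (at z)" if "z \<in> U" for z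
    using Suc.prems that \<open>open U\<close> unfolding Ck_on.simps differentiable_def
    by (meson has_derivative_transform_within_open)
  moreover have "Ck_on k U (partial_deriv i G)" for i
    using Suc.IH[of "partial_deriv i F" "partial_deriv i G"] Suc.prems
      partial_deriv_cong[OF \<open>open U\<close>, of _ F G i] by simp
  ultimately show ?case by simp
qed

lemma Ck_on_add:
  assumes "open U" and "Ck_on k U F" and "Ck_on k U G"
  shows "Ck_on k U (\<lambda>z. F z + G z)"
  using assms(2,3)
proof (induction k arbitrary: F G)
  case 0
  then show ?case by (simp add: continuous_on_add)
next
  case (Suc k)
  have "Ck_on k U (partial_deriv i (\<lambda>z. F z + G z))" for i
    by (rule Ck_on_cong[OF \<open>open U\<close> Suc.IH[of "partial_deriv i F" "partial_deriv i G"]])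
      (use Suc.prems in \<open>simp_all add: partial_deriv_add\<close>)
  then show ?case using Suc.prems by (simp add: differentiable_add)
qed

lemma Ck_on_mult:
  assumes "open U" and "Ck_on k U F" and "Ck_on k U G"
  shows "Ck_on k U (\<lambda>z. F z * G z)"
  using assms(2,3)
proof (induction k arbitrary: F G)
  case 0
  then show ?case by (simp add: continuous_on_mult)
next
  case (Suc k)
  have "Ck_on k U (\<lambda>z. F z * partial_deriv i G z + partial_deriv i F z * G z)" for i
    using Suc Suc.prems[THEN Ck_on_Suc_imp] by (intro Ck_on_add[OF \<open>open U\<close>] Suc.IH) auto
  then have "Ck_on k U (partial_deriv i (\<lambda>z. F z * G z))" for i
    by (rule Ck_on_cong[OF \<open>open U\<close>]) (use Suc.prems in \<open>simp add: partial_deriv_mult\<close>)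
  then show ?case using Suc.prems by (simp add: differentiable_mult)
qed

lemma Ck_on_const: "Ck_on k U (\<lambda>z. c)"
proof (induction k arbitrary: c)
  case (Suc k)
  have "partial_deriv i (\<lambda>z. c) = (\<lambda>z. 0)" for i :: 'a
    by (simp add: fun_eq_iff partial_deriv_const)
  then show ?case using Suc by simp
qed simp

lemma smooth_on_const: "smooth_on U (\<lambda>z. c)"
  by (simp add: smooth_on_def Ck_on_const)

lemma smooth_on_coordinate: "smooth_on U (\<lambda>z. z $ j)"
  unfolding smooth_on_def
proof
  fix k
  have D: "partial_deriv i (\<lambda>z. z $ j) = (\<lambda>z. if i = j then 1 else 0)" for i
    by (simp add: fun_eq_iff partial_deriv_coordinate)
  have "(\<lambda>z. z $ j) differentiable (at z)" for z :: "real ^ 'a"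
    by (intro bounded_linear_imp_differentiable bounded_linear_vec_nth)
  then show "Ck_on k U (\<lambda>z. z $ j)"
    by (cases k) (simp_all add: D Ck_on_const continuous_intros)
qed

lemma smooth_on_add:
  "open U \<Longrightarrow> smooth_on U F \<Longrightarrow> smooth_on U G \<Longrightarrow> smooth_on U (\<lambda>z. F z + G z)"
  by (simp add: smooth_on_def Ck_on_add)

lemma smooth_on_mult:
  "open U \<Longrightarrow> smooth_on U F \<Longrightarrow> smooth_on U G \<Longrightarrow> smooth_on U (\<lambda>z. F z * G z)"
  by (simp add: smooth_on_def Ck_on_mult)

lemma smooth_on_sum:
  assumes "open U" and "\<And>i. i \<in> I \<Longrightarrow> smooth_on U (F i)"
  shows "smooth_on U (\<lambda>z. \<Sum>i\<in>I. F i z)"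
  using assms by (induction I rule: infinite_finite_induct) (simp_all add: smooth_on_const smooth_on_add)

lemma smooth_on_partial_deriv: "smooth_on U F \<Longrightarrow> smooth_on U (partial_deriv i F)"
  unfolding smooth_on_def by (metis Ck_on.simps(2))

lemma smooth_on_imp_differentiable: "smooth_on U F \<Longrightarrow> z \<in> U \<Longrightarrow> F differentiable (at z)"
  unfolding smooth_on_def by (metis Ck_on.simps(2))

lemmas smooth_on_intros =
  smooth_on_const smooth_on_coordinate smooth_on_add smooth_on_mult smooth_on_sum smooth_on_partial_deriv

lemma partial_deriv_sum:
  assumes "open U" and "\<And>j. j \<in> I \<Longrightarrow> smooth_on U (F j)" and "z \<in> U"
  shows "partial_deriv i (\<lambda>z. \<Sum>j\<in>I. F j z) z = (\<Sum>j\<in>I. partial_deriv i (F j) z)"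
  using assms
proof (induction I rule: infinite_finite_induct)
  case (insert j I)
  then have "partial_deriv i (\<lambda>z. F j z + (\<Sum>j\<in>I. F j z)) z
      = partial_deriv i (F j) z + partial_deriv i (\<lambda>z. \<Sum>j\<in>I. F j z) z"
    by (intro partial_deriv_add smooth_on_imp_differentiable[of U] smooth_on_sum) auto
  with insert show ?case by simp
qed (simp_all add: partial_deriv_const)

section \<open>Symmetry of second partial derivatives\<close>

text \<open>
  The second difference of \<open>F\<close> over a small square is, by two applications of the mean value theorem,
  a value of one mixed derivative. As the second difference is symmetric in the two directions, it
  is also a value of the other mixed derivative, at a different nearby point.
\<close>

lemma double_mean_value:
  fixes F :: "real ^ 'n::finite \<Rightarrow> real"
  assumes "smooth_on U F" and U: "ball z r \<subseteq> U" and "0 < t" and "2 * t < r"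
  shows "\<exists>w\<in>ball z r. F (z + t *\<^sub>R axis i 1 + t *\<^sub>R axis j 1) - F (z + t *\<^sub>R axis i 1)
           - F (z + t *\<^sub>R axis j 1) + F z = t * (t * partial_deriv j (partial_deriv i F) w)"
proof -
  have ball: "z + x *\<^sub>R axis i 1 + y *\<^sub>R axis j 1 \<in> ball z r"
    if "0 \<le> x" "x \<le> t" "0 \<le> y" "y \<le> t" for x y
  proof -
    have "norm (x *\<^sub>R axis i 1 + y *\<^sub>R axis j (1::real))
        \<le> norm (x *\<^sub>R axis i (1::real)) + norm (y *\<^sub>R axis j (1::real))"
      by (rule norm_triangle_ineq)
    also have "\<dots> < r" using that assms by simp
    finally have "norm (x *\<^sub>R axis i 1 + y *\<^sub>R axis j (1::real)) < r" .
    moreover have "dist z (z + v) = norm v" for v :: "real ^ 'n"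
      by (simp add: dist_norm)
    ultimately show ?thesis by (simp only: mem_ball add.assoc)
  qed
  have diff: "G differentiable (at (z + x *\<^sub>R axis i 1 + y *\<^sub>R axis j 1))"
    if "smooth_on U G" "0 \<le> x" "x \<le> t" "0 \<le> y" "y \<le> t" for G x y
    using smooth_on_imp_differentiable[OF that(1)] ball[OF that(2-)] U by blast
  define g where "g x = F (z + t *\<^sub>R axis j 1 + x *\<^sub>R axis i 1) - F (z + x *\<^sub>R axis i 1)" for x
  have "\<exists>x. 0 < x \<and> x < t \<and> g t - g 0 = (t - 0) * (partial_deriv i F (z + t *\<^sub>R axis j 1 + x *\<^sub>R axis i 1)
      - partial_deriv i F (z + x *\<^sub>R axis i 1))"
    unfolding g_def using diff[OF assms(1), of _ t] diff[OF assms(1), of _ 0] \<open>0 < t\<close>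
    by (intro MVT2 derivative_intros DERIV_along_axis) (auto simp: add_ac)
  \<comment> \<open>The summand with factor \<open>0\<close> puts the difference into the form of an increment along axis \<open>j\<close>.\<close>
  then obtain x where x: "0 < x" "x < t" and g: "g t - g 0 =
      t * (partial_deriv i F (z + x *\<^sub>R axis i 1 + t *\<^sub>R axis j 1)
           - partial_deriv i F (z + x *\<^sub>R axis i 1 + 0 *\<^sub>R axis j 1))"
    by (auto simp: add_ac)
  have "\<exists>y. 0 < y \<and> y < t \<and> partial_deriv i F (z + x *\<^sub>R axis i 1 + t *\<^sub>R axis j 1)
      - partial_deriv i F (z + x *\<^sub>R axis i 1 + 0 *\<^sub>R axis j 1)
      = (t - 0) * partial_deriv j (partial_deriv i F) (z + x *\<^sub>R axis i 1 + y *\<^sub>R axis j 1)"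
    using diff[OF smooth_on_partial_deriv[OF assms(1)], of x] x \<open>0 < t\<close>
    by (intro MVT2 DERIV_along_axis) auto
  then obtain y where y: "0 < y" "y < t"
    and "g t - g 0
      = t * (t * partial_deriv j (partial_deriv i F) (z + x *\<^sub>R axis i 1 + y *\<^sub>R axis j 1))"
    using g by auto
  moreover have "z + x *\<^sub>R axis i 1 + y *\<^sub>R axis j 1 \<in> ball z r"
    using x y by (intro ball) auto
  ultimately show ?thesis by (intro bexI) (simp_all add: g_def add_ac)
qed

text \<open>
  Schwarz's theorem. If the two mixed derivatives differed at \<open>z\<close>, then by continuity they would
  take no common value near \<open>z\<close>, but \<open>double_mean_value\<close> provides one.
\<close>

lemma partial_deriv_commute:
  fixes F :: "real ^ 'n::finite \<Rightarrow> real"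
  assumes "open U" and F: "smooth_on U F" and "z \<in> U"
  shows "partial_deriv i (partial_deriv j F) z = partial_deriv j (partial_deriv i F) z"
proof (rule ccontr)
  let ?A = "partial_deriv i (partial_deriv j F)" and ?B = "partial_deriv j (partial_deriv i F)"
  assume ne: "?A z \<noteq> ?B z"
  define e where "e = dist (?A z) (?B z) / 2"
  have "e > 0" using ne by (simp add: e_def)
  have "isCont ?A z" "isCont ?B z"
    using F \<open>z \<in> U\<close> by (auto intro!: differentiable_imp_continuous_within
        smooth_on_imp_differentiable[of U] smooth_on_partial_deriv)
  then obtain d1 d2 where d: "d1 > 0" "d2 > 0"
    "\<And>w. dist w z < d1 \<Longrightarrow> dist (?A w) (?A z) < e" "\<And>w. dist w z < d2 \<Longrightarrow> dist (?B w) (?B z) < e"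
    using \<open>e > 0\<close> unfolding continuous_at_eps_delta by metis
  obtain r0 where "r0 > 0" "ball z r0 \<subseteq> U" using assms open_contains_ball by blast
  define r where "r = min r0 (min d1 d2)"
  have r: "r > 0" "ball z r \<subseteq> U" using d \<open>r0 > 0\<close> \<open>ball z r0 \<subseteq> U\<close> by (auto simp: r_def)
  have t: "0 < r / 3" "2 * (r / 3) < r" using r by auto
  obtain w w' where "w \<in> ball z r" "w' \<in> ball z r" "?A w = ?B w'"
    using double_mean_value[OF F r(2) t, of i j] double_mean_value[OF F r(2) t, of j i] r(1)
    by (auto simp: add_ac diff_diff_eq)
  moreover have "dist (?A w) (?A z) < e" "dist (?B w') (?B z) < e"
    using \<open>w \<in> ball z r\<close> \<open>w' \<in> ball z r\<close> by (auto intro!: d simp: r_def dist_commute)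
  ultimately have "dist (?A z) (?B z) < 2 * e"
    by (simp add: dist_real_def)
  then show False by (simp add: e_def)
qed

section \<open>The Laplacian and the Euler operator\<close>

text \<open>
  The entries of the diagonal metric. They turn the Laplacian into a single sum over all coordinates,
  so that the two kinds of coordinates need no separate treatment.
\<close>

definition metric_sign :: "'n set \<Rightarrow> 'n \<Rightarrow> real" where
  "metric_sign P i = (if i \<in> P then 1 else - 1)"

definition euler :: "(real ^ 'n::finite \<Rightarrow> real) \<Rightarrow> real ^ 'n \<Rightarrow> real" where
  "euler F z = (\<Sum>i\<in>UNIV. z $ i * partial_deriv i F z)"

lemma metric_sign_square: "metric_sign P i * (metric_sign P i * x) = x"
  by (cases "i \<in> P") (simp_all add: metric_sign_def)

lemma sum_metric_sign:
  fixes f :: "'n::finite \<Rightarrow> real"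
  shows "(\<Sum>i\<in>P. f i) - (\<Sum>i\<in>- P. f i) = (\<Sum>i\<in>UNIV. metric_sign P i * f i)"
proof -
  have "(\<Sum>i\<in>UNIV. metric_sign P i * f i)
      = (\<Sum>i\<in>P. metric_sign P i * f i) + (\<Sum>i\<in>- P. metric_sign P i * f i)"
    by (subst sum.union_disjoint[symmetric]) simp_all
  also have "(\<Sum>i\<in>P. metric_sign P i * f i) = (\<Sum>i\<in>P. f i)"
    by (rule sum.cong) (simp_all add: metric_sign_def)
  also have "(\<Sum>i\<in>- P. metric_sign P i * f i) = (\<Sum>i\<in>- P. - f i)"
    by (rule sum.cong) (simp_all add: metric_sign_def)
  finally show ?thesis by (simp add: sum_negf)
qed

lemma laplacian_metric_sign:
  "laplacian P F = (\<lambda>z. \<Sum>i\<in>UNIV. metric_sign P i * partial_deriv i (partial_deriv i F) z)"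
  by (rule ext) (simp only: laplacian_def sum_metric_sign)

lemma smooth_on_laplacian_power:
  "open U \<Longrightarrow> smooth_on U F \<Longrightarrow> smooth_on U ((laplacian P ^^ k) F)"
  by (induction k) (auto simp: laplacian_metric_sign intro!: smooth_on_intros)

lemma laplacian_cong:
  assumes "open U" and "z \<in> U" and "\<And>w. w \<in> U \<Longrightarrow> F w = G w"
  shows "laplacian P F z = laplacian P G z"
proof -
  have "partial_deriv i (partial_deriv i F) z = partial_deriv i (partial_deriv i G) z" for i
    using assms by (intro partial_deriv_cong[OF assms(1,2)]) (rule partial_deriv_cong)
  then show ?thesis by (simp add: laplacian_def)
qed

lemma laplacian_const: "laplacian P (\<lambda>z. c) z = 0"
proof -
  have "partial_deriv i (\<lambda>z. c) = (\<lambda>z. 0)" for i :: 'a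
    by (simp add: fun_eq_iff partial_deriv_const)
  then show ?thesis by (simp add: laplacian_def partial_deriv_const)
qed

lemma laplacian_coordinate: "laplacian P (\<lambda>z. z $ j) z = 0"
proof -
  have "partial_deriv i (\<lambda>z. z $ j) = (\<lambda>z. if i = j then 1 else 0)" for i
    by (simp add: fun_eq_iff partial_deriv_coordinate)
  then show ?thesis by (simp add: laplacian_def partial_deriv_const)
qed

context
  fixes U :: "(real ^ 'n::finite) set"
  assumes U: "open U"
begin

lemma laplacian_add:
  assumes "smooth_on U F" and "smooth_on U G" and z: "z \<in> U"
  shows "laplacian P (\<lambda>z. F z + G z) z = laplacian P F z + laplacian P G z"
proof -
  note d = smooth_on_imp_differentiable[of U]
  have "partial_deriv i (partial_deriv i (\<lambda>z. F z + G z)) z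
      = partial_deriv i (\<lambda>z. partial_deriv i F z + partial_deriv i G z) z" for i
    using assms by (intro partial_deriv_cong[OF U z] partial_deriv_add d)
  then show ?thesis
    using assms by (simp add: laplacian_metric_sign partial_deriv_add d smooth_on_intros
        sum.distrib ring_distribs)
qed

lemma laplacian_mult:
  assumes "smooth_on U F" and "smooth_on U G" and z: "z \<in> U"
  shows "laplacian P (\<lambda>z. F z * G z) z = F z * laplacian P G z + laplacian P F z * G z
           + 2 * (\<Sum>i\<in>UNIV. metric_sign P i * (partial_deriv i F z * partial_deriv i G z))"
proof -
  note d = smooth_on_imp_differentiable[of U]
  have "partial_deriv i (partial_deriv i (\<lambda>z. F z * G z)) z
      = partial_deriv i (\<lambda>z. F z * partial_deriv i G z + partial_deriv i F z * G z) z" for i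
    using assms by (intro partial_deriv_cong[OF U z] partial_deriv_mult d)
  also have "\<dots> i = F z * partial_deriv i (partial_deriv i G) z
      + partial_deriv i (partial_deriv i F) z * G z + 2 * (partial_deriv i F z * partial_deriv i G z)" for i
    using assms U by (simp add: partial_deriv_add partial_deriv_mult d smooth_on_intros)
  finally show ?thesis
    by (simp add: laplacian_metric_sign sum.distrib ring_distribs sum_distrib_left sum_distrib_right mult_ac)
qed

lemma laplacian_cmult:
  assumes "smooth_on U F" and "z \<in> U"
  shows "laplacian P (\<lambda>z. c * F z) z = c * laplacian P F z"
  using laplacian_mult[OF smooth_on_const assms] by (simp add: laplacian_const partial_deriv_const)

lemma laplacian_sum:
  assumes "\<And>i. i \<in> I \<Longrightarrow> smooth_on U (F i)" and "z \<in> U"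
  shows "laplacian P (\<lambda>z. \<Sum>i\<in>I. F i z) z = (\<Sum>i\<in>I. laplacian P (F i) z)"
  using assms
proof (induction I rule: infinite_finite_induct)
  case (insert j I)
  then have "laplacian P (\<lambda>z. F j z + (\<Sum>j\<in>I. F j z)) z
      = laplacian P (F j) z + laplacian P (\<lambda>z. \<Sum>j\<in>I. F j z) z"
    using U by (intro laplacian_add smooth_on_sum) auto
  with insert show ?case by simp
qed (simp_all add: laplacian_const)

lemma partial_deriv_laplacian:
  assumes F: "smooth_on U F" and z: "z \<in> U"
  shows "partial_deriv j (laplacian P F) z = laplacian P (partial_deriv j F) z"
proof -
  note d = smooth_on_imp_differentiable[of U]
  have "partial_deriv j (laplacian P F) z
      = (\<Sum>i\<in>UNIV. metric_sign P i * partial_deriv j (partial_deriv i (partial_deriv i F)) z)"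
    unfolding laplacian_metric_sign using F z U
    by (subst partial_deriv_sum[OF U])
       (simp_all add: partial_deriv_mult partial_deriv_const d smooth_on_intros)
  moreover have "partial_deriv j (partial_deriv i (partial_deriv i F)) z
      = partial_deriv i (partial_deriv i (partial_deriv j F)) z" for i
  proof -
    have "partial_deriv j (partial_deriv i (partial_deriv i F)) z
        = partial_deriv i (partial_deriv j (partial_deriv i F)) z"
      using F z by (intro partial_deriv_commute[OF U] smooth_on_intros)
    also have "\<dots> = partial_deriv i (partial_deriv i (partial_deriv j F)) z"
      using F by (intro partial_deriv_cong[OF U z] partial_deriv_commute[OF U])
    finally show ?thesis .
  qed
  ultimately show ?thesis by (simp add: laplacian_metric_sign)
qed

lemma smooth_on_euler: "smooth_on U F \<Longrightarrow> smooth_on U (euler F)"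
  unfolding euler_def[abs_def] using U by (intro smooth_on_intros)

text \<open>
  The commutator \<open>[\<Delta>, E] = 2 \<Delta>\<close> expresses that \<open>\<Delta>\<close> lowers the degree of homogeneity by two. In
  coordinates, each summand \<open>z\<^sub>j \<partial>\<^sub>jF\<close> contributes the cross term of the product rule, and these cross
  terms add up to \<open>2 \<Delta>F\<close>.
\<close>

lemma laplacian_euler:
  assumes F: "smooth_on U F" and z: "z \<in> U"
  shows "laplacian P (euler F) z = euler (laplacian P F) z + 2 * laplacian P F z"
proof -
  have "laplacian P (euler F) z = (\<Sum>j\<in>UNIV. laplacian P (\<lambda>z. z $ j * partial_deriv j F z) z)"
    unfolding euler_def[abs_def] using F U z by (intro laplacian_sum smooth_on_intros)
  also have "\<dots> = (\<Sum>j\<in>UNIV. z $ j * laplacian P (partial_deriv j F) z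
      + 2 * (metric_sign P j * partial_deriv j (partial_deriv j F) z))"
    using F z by (simp add: laplacian_mult smooth_on_intros laplacian_coordinate
        partial_deriv_coordinate if_distrib[of "\<lambda>x. _ * x"] if_distrib[of "\<lambda>x. x * _"] cong: if_cong)
  also have "\<dots> = euler (laplacian P F) z + 2 * laplacian P F z"
  proof -
    have "(\<Sum>j\<in>UNIV. z $ j * laplacian P (partial_deriv j F) z) = euler (laplacian P F) z"
      using F z by (simp add: euler_def partial_deriv_laplacian)
    then show ?thesis
      by (simp add: sum.distrib laplacian_metric_sign flip: sum_distrib_left)
  qed
  finally show ?thesis .
qed

end

section \<open>Multiplication by a quadratic function\<close>

text \<open>
  This is the function \<open>H\<close>, written with sums and products of constants and coordinates only, so
  that the closure rules for smooth functions apply.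
\<close>

definition quadratic :: "'n::finite set \<Rightarrow> real \<Rightarrow> real \<Rightarrow> real ^ 'n \<Rightarrow> real" where
  "quadratic P c1 c2 z = (\<Sum>i\<in>UNIV. (c1 * metric_sign P i) * (z $ i * z $ i)) + c2"

lemma smooth_on_quadratic: "open U \<Longrightarrow> smooth_on U (quadratic P c1 c2)"
  unfolding quadratic_def[abs_def] by (intro smooth_on_intros)

lemma partial_deriv_quadratic:
  "partial_deriv i (quadratic P c1 c2) z = 2 * c1 * (metric_sign P i * z $ i)"
proof -
  note d = smooth_on_imp_differentiable[OF _ UNIV_I]
  let ?f = "\<lambda>j z. (c1 * metric_sign P j) * (z $ j * z $ j)"
  have f: "smooth_on UNIV (?f j)" for j
    by (intro smooth_on_intros open_UNIV)
  have "partial_deriv i (quadratic P c1 c2) z = partial_deriv i (\<lambda>z. \<Sum>j\<in>UNIV. ?f j z) z"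
    unfolding quadratic_def[abs_def]
    by (subst partial_deriv_add) (auto simp: partial_deriv_const intro!: d smooth_on_intros)
  also have "\<dots> = (\<Sum>j\<in>UNIV. partial_deriv i (?f j) z)"
    by (rule partial_deriv_sum[OF open_UNIV f UNIV_I])
  also have "\<dots> = (\<Sum>j\<in>UNIV. if i = j then 2 * c1 * (metric_sign P i * z $ i) else 0)"
    by (intro sum.cong refl)
       (auto simp: partial_deriv_mult partial_deriv_const partial_deriv_coordinate d smooth_on_intros)
  finally show ?thesis by simp
qed

lemma laplacian_quadratic:
  fixes P :: "'n::finite set"
  shows "laplacian P (quadratic P c1 c2) z = 2 * c1 * CARD('n)"
proof -
  note d = smooth_on_imp_differentiable[OF _ UNIV_I]
  have *: "partial_deriv i (quadratic P c1 c2) = (\<lambda>z. (2 * c1 * metric_sign P i) * z $ i)" for i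
    by (simp add: fun_eq_iff partial_deriv_quadratic)
  have "metric_sign P i * partial_deriv i (partial_deriv i (quadratic P c1 c2)) z = 2 * c1" for i
    unfolding * using metric_sign_square[of P i 1]
    by (simp add: partial_deriv_mult partial_deriv_const partial_deriv_coordinate d smooth_on_intros mult_ac)
  then show ?thesis by (simp add: laplacian_metric_sign)
qed

text \<open>
  The metric signs in the Laplacian cancel against those in the gradient of the quadratic function;
  hence the cross term of the product rule is the Euler operator, whatever the signature.
\<close>

lemma laplacian_quadratic_mult:
  fixes P :: "'n::finite set" and F :: "real ^ 'n \<Rightarrow> real"
  assumes "open U" and "smooth_on U F" and "z \<in> U"
  shows "laplacian P (\<lambda>z. quadratic P c1 c2 z * F z) z
    = quadratic P c1 c2 z * laplacian P F z + c1 * (4 * euler F z + 2 * CARD('n) * F z)"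
proof -
  have "metric_sign P i * (partial_deriv i (quadratic P c1 c2) z * partial_deriv i F z)
      = 2 * c1 * (z $ i * partial_deriv i F z)" for i
    using metric_sign_square[of P i 1] by (simp add: partial_deriv_quadratic)
  then have "(\<Sum>i\<in>UNIV. metric_sign P i * (partial_deriv i (quadratic P c1 c2) z * partial_deriv i F z))
      = 2 * c1 * euler F z"
    by (simp only: euler_def sum_distrib_left)
  then show ?thesis
    using assms by (simp add: laplacian_mult smooth_on_quadratic laplacian_quadratic algebra_simps)
qed

text \<open>
  The coefficient \<open>(k + 1) (2 m + 4 k)\<close> solves the recursion \<open>b\<^sub>k = b\<^sub>k\<^sub>-\<^sub>1 + 2 m + 8 k\<close>: one
  application of \<open>\<Delta>\<close> adds \<open>2 m\<close> from the product with \<open>H\<close>, and \<open>8 k\<close> from commuting \<open>\<Delta>\<close> past \<open>4 k E\<close>.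
\<close>

lemma laplacian_power_quadratic_mult:
  fixes P :: "'n::finite set"
  assumes U: "open U" and F: "smooth_on U F" and "z \<in> U"
  shows "(laplacian P ^^ Suc k) (\<lambda>z. quadratic P c1 c2 z * F z) z
    = quadratic P c1 c2 z * (laplacian P ^^ Suc k) F z
      + c1 * (4 * Suc k * euler ((laplacian P ^^ k) F) z
              + Suc k * (2 * CARD('n) + 4 * k) * (laplacian P ^^ k) F z)"
  using \<open>z \<in> U\<close>
proof (induction k arbitrary: z)
  case 0
  then show ?case using laplacian_quadratic_mult[OF U F] by simp
next
  case (Suc k)
  define a b :: real where "a = c1 * (4 * Suc k)" and "b = c1 * (Suc k * (2 * CARD('n) + 4 * k))"
  let ?H = "quadratic P c1 c2"
  define G where "G = (laplacian P ^^ k) F"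
  have G: "smooth_on U G" "smooth_on U (laplacian P G)"
    using smooth_on_laplacian_power[OF U F, where P = P and k = k] smooth_on_laplacian_power[OF U F, where P = P and k = "Suc k"]
    by (simp_all add: G_def)
  have "(laplacian P ^^ Suc (Suc k)) (\<lambda>z. ?H z * F z) z
      = laplacian P (\<lambda>z. ?H z * laplacian P G z + (a * euler G z + b * G z)) z"
    unfolding funpow.simps(2)[of "Suc k"] o_def
    by (rule laplacian_cong[OF U \<open>z \<in> U\<close>])
       (use Suc.IH in \<open>simp add: a_def b_def G_def algebra_simps\<close>)
  also have "\<dots> = laplacian P (\<lambda>z. ?H z * laplacian P G z) z
      + (a * laplacian P (euler G) z + b * laplacian P G z)"
    using G U Suc.prems
    by (simp add: laplacian_add laplacian_cmult smooth_on_intros smooth_on_euler smooth_on_quadratic)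
  also have "\<dots> = ?H z * laplacian P (laplacian P G) z
      + c1 * (4 * Suc (Suc k) * euler (laplacian P G) z
              + Suc (Suc k) * (2 * CARD('n) + 4 * Suc k) * laplacian P G z)"
    unfolding laplacian_quadratic_mult[OF U G(2) Suc.prems] laplacian_euler[OF U G(1) Suc.prems]
      a_def b_def by (simp add: algebra_simps)
  finally show ?case by (simp add: G_def)
qed

section \<open>Homogeneous functions of negative degree\<close>

text \<open>
  Along a ray, Euler's equation makes \<open>t\<^sup>n\<^sup>/\<^sup>2 u(t z)\<close> constant. Squaring it avoids the half-integral
  exponent, and then the constant is the value at \<open>t = 0\<close>, which is zero because \<open>n > 0\<close>.
\<close>

lemma euler_negative_degree_imp_zero:
  fixes u :: "real ^ 'n::finite \<Rightarrow> real"
  assumes u: "\<And>z. u differentiable (at z)" and "n > 0"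
    and euler: "\<And>z. 2 * euler u z + real n * u z = 0"
  shows "u z = 0"
proof -
  define \<psi> where "\<psi> t = t ^ n * (u (t *\<^sub>R z))\<^sup>2" for t :: real
  have "(\<psi> has_real_derivative 0) (at t)" for t
  proof -
    let ?D = "\<Sum>i\<in>UNIV. z $ i * partial_deriv i u (t *\<^sub>R z)"
    have "((\<lambda>t. u (t *\<^sub>R z)) has_real_derivative ?D) (at t)"
      using DERIV_along_line[OF u, where z = 0 and t = t and v = z] by simp
    then have "(\<psi> has_real_derivative
        n * t ^ (n - 1) * (u (t *\<^sub>R z))\<^sup>2 + t ^ n * (2 * u (t *\<^sub>R z) * ?D)) (at t)"
      unfolding \<psi>_def by (auto intro!: derivative_eq_intros)
    moreover have "n * t ^ (n - 1) * (u (t *\<^sub>R z))\<^sup>2 + t ^ n * (2 * u (t *\<^sub>R z) * ?D)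
        = t ^ (n - 1) * u (t *\<^sub>R z) * (2 * euler u (t *\<^sub>R z) + real n * u (t *\<^sub>R z))"
      using \<open>n > 0\<close> power_minus_mult[of n t]
      by (simp add: euler_def power2_eq_square mult.assoc flip: sum_distrib_left)
         (simp add: algebra_simps)
    ultimately show ?thesis using euler[of "t *\<^sub>R z"] by simp
  qed
  then have "\<psi> 1 = \<psi> 0" by (metis DERIV_isconst_all)
  then show ?thesis using \<open>n > 0\<close> by (simp add: \<psi>_def zero_power)
qed

section \<open>Products of harmonic functions with a quadratic function\<close>

theorem mainTheorem3:
  fixes p q s :: nat
    and P :: "'n::finite set"
    and c1 c2 :: real
    and H :: "real ^ 'n \<Rightarrow> real"
  assumes "card P = p" and "card (- P) = q"
    and "p \<ge> 1" and "q \<ge> 0"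
    and "c1 \<noteq> 0"
    and "\<And>z. H z = c1 * ((\<Sum>i\<in>P. (z $ i)\<^sup>2) - (\<Sum>j\<in>- P. (z $ j)\<^sup>2)) + c2"
    and "s \<ge> 1"
  shows "(\<forall>U F. open U \<and> s_harmonic_on P s U F \<longrightarrow> s_harmonic_on P (s + 1) U (\<lambda>z. H z * F z)) \<and>
         (\<forall>F. proper_s_harmonic_on P s UNIV F \<longrightarrow> proper_s_harmonic_on P (s + 1) UNIV (\<lambda>z. H z * F z))"
proof -
  have H: "H = quadratic P c1 c2"
  proof
    fix z
    show "H z = quadratic P c1 c2 z"
      unfolding assms(6) sum_metric_sign quadratic_def sum_distrib_left
      by (simp add: power2_eq_square mult.assoc)
  qed
  obtain k where s: "s = Suc k" using \<open>s \<ge> 1\<close> by (cases s) auto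
  have harmonic: "s_harmonic_on P (s + 1) U (\<lambda>z. H z * F z)"
    if U: "open U" and F: "s_harmonic_on P s U F" for U F
  proof -
    have smooth: "smooth_on U F" and zero: "\<And>z. z \<in> U \<Longrightarrow> (laplacian P ^^ s) F z = 0"
      using F by (auto simp: s_harmonic_on_def)
    have "(laplacian P ^^ (s + 1)) (\<lambda>z. H z * F z) z = 0" if z: "z \<in> U" for z
    proof -
      have "laplacian P ((laplacian P ^^ s) F) z = 0"
        using laplacian_cong[OF U z, of "(laplacian P ^^ s) F" "\<lambda>_. 0" P] zero
        by (simp add: laplacian_const)
      moreover have "partial_deriv i ((laplacian P ^^ s) F) z = 0" for i
        using partial_deriv_cong[OF U z, of "(laplacian P ^^ s) F" "\<lambda>_. 0" i] zero
        by (simp add: partial_deriv_const)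
      ultimately show ?thesis
        using laplacian_power_quadratic_mult[OF U smooth z,
            where P = P and k = s and ?c1.0 = c1 and ?c2.0 = c2] zero[OF z]
        by (simp add: H euler_def)
    qed
    then show ?thesis
      using U smooth by (simp add: s_harmonic_on_def H smooth_on_mult smooth_on_quadratic)
  qed
  have "proper_s_harmonic_on P (s + 1) UNIV (\<lambda>z. H z * F z)"
    if F: "proper_s_harmonic_on P s UNIV F" for F
  proof -
    define u where "u = (laplacian P ^^ k) F"
    define n where "n = CARD('n) + 2 * k"
    have smooth: "smooth_on UNIV F" and zero: "\<And>z. (laplacian P ^^ s) F z = 0"
      and F': "s_harmonic_on P s UNIV F" and "\<exists>z. u z \<noteq> 0"
      using F by (auto simp: proper_s_harmonic_on_def s_harmonic_on_def u_def s)
    have "u differentiable (at z)" for z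
      unfolding u_def using smooth
      by (intro smooth_on_imp_differentiable[OF smooth_on_laplacian_power]) auto
    moreover have "n > 0" by (simp add: n_def)
    ultimately obtain z where z: "2 * euler u z + real n * u z \<noteq> 0"
      using euler_negative_degree_imp_zero[of u n] \<open>\<exists>z. u z \<noteq> 0\<close> by blast
    have "(laplacian P ^^ s) (\<lambda>z. H z * F z) z = 2 * real s * c1 * (2 * euler u z + real n * u z)"
      using laplacian_power_quadratic_mult[OF open_UNIV smooth UNIV_I,
          where P = P and k = k and ?c1.0 = c1 and ?c2.0 = c2 and z = z] zero[of z]
      unfolding s H by (simp add: u_def n_def algebra_simps)
    then have "(laplacian P ^^ s) (\<lambda>z. H z * F z) z \<noteq> 0"
      using z \<open>c1 \<noteq> 0\<close> by (simp add: s)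
    then show ?thesis
      using harmonic[OF open_UNIV F'] by (auto simp: proper_s_harmonic_on_def)
  qed
  with harmonic show ?thesis by blast
qed

end
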